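(* Let $\mathbb{A}$ be a $k$-letter alphabet and $\pi=(<_D,<_A)$ a pair of distinct total orders on $\mathbb{A}$. For any pair of (nonempty) words $u,v$ over $\mathbb{A}$, $$|T_2(u,v)|-|T_1(u,v)|=\lambda(u)^T\,\Omega\,\lambda(v),$$ where $\Omega=(\Omega_{i,j})_{i,j\in\mathbb{A}}$ is the $k\times k$ skew-symmetric matrix defined by $\Omega_{i,j}=+1$ if $j<_A i$ and $i<_D j$; $\Omega_{i,j}=-1$ if $j<_D i$ and $i<_A j$; and $\Omega_{i,j}=0$ otherwise.
   Context: For a word $w$ over $\mathbb{A}$, $\lambda(w)=(|w|_a)_{a\in\mathbb{A}}\in\mathbb{R}^{\mathbb{A}}$ is its Parikh vector, where $|w|_a$ is the number of occurrences of the letter $a$ in $w$. For nonempty words $w,z$ put $w^\omega=www\cdots$ (right-infinite) and $w^{-\omega}=\cdots www$ (left-infinite). Write $w<_D z$ if $w^\omega$ is lexicographically smaller than $z^\omega$ with respect to the order $<_D$ on letters (reading from left to right), and $w<_A z$ if $w^{-\omega}$ is reverse-lexicographically smaller than $z^{-\omega}$ with respect to $<_A$ (reading from right to left: at the first position from the right where they differ, the letter of $w^{-\omega}$ is $<_A$ the letter of $z^{-\omega}$). Write $u=u_1\cdots u_s$ and $v=v_1\cdots v_r$, with indices of $u$ taken modulo $s$ and indices of $v$ taken modulo $r$; $u_{j+1}\cdots u_j$ denotes the conjugate $u_{j+1}\cdots u_s u_1\cdots u_j$ of $u$, and $v_{i+1}\cdots v_i$ denotes the conjugate $v_{i+1}\cdots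 v_r v_1\cdots v_i$ of $v$. Let $R=\{(i,j): 1\le i\le r,\ 1\le j\le s\}$ and define $$T_1(u,v)=\{(i,j)\in R:\ v_i\ne u_j\ \text{and}\ u_{j+1}\cdots u_j<_A v_{i+1}\cdots v_i<_D u_{j+1}\cdots u_j\},$$ $$T_2(u,v)=\{(i,j)\in R:\ v_{i+1}\ne u_{j+1}\ \text{and}\ v_{i+1}\cdots v_i<_A u_{j+1}\cdots u_j<_D v_{i+1}\cdots v_i\}.$$ *)

theory Defs
  imports "HOL-Analysis.Analysis" "HOL-Library.Omega_Words_Fun"
begin

text \<open>
  Strict total orders on the alphabet are relations \<open>r\<close> with \<open>strict_linear_order r\<close>; the pair
  \<open>(a, b) \<in> r\<close> means that \<open>a\<close> is smaller than \<open>b\<close>.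
\<close>

definition parikh :: "'a::finite list \<Rightarrow> real ^ 'a" where
  "parikh w = (\<chi> a. real (count_list w a))"

definition omega_less :: "'a rel \<Rightarrow> (nat \<Rightarrow> 'a) \<Rightarrow> (nat \<Rightarrow> 'a) \<Rightarrow> bool" where
  "omega_less r x y \<longleftrightarrow> (\<exists>n. (\<forall>m<n. x m = y m) \<and> (x n, y n) \<in> r)"

definition less_D :: "'a rel \<Rightarrow> 'a list \<Rightarrow> 'a list \<Rightarrow> bool" where
  "less_D D w z \<longleftrightarrow> omega_less D (w\<^sup>\<omega>) (z\<^sup>\<omega>)"

text \<open>
  The left-infinite word \<open>\<cdots>www\<close>, indexed from its right end: \<open>left_iter w n\<close> is the letter with
  exactly \<open>n\<close> letters to its right.
\<close>

definition left_iter :: "'a list \<Rightarrow> nat \<Rightarrow> 'a" where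
  "left_iter w = (rev w)\<^sup>\<omega>"

definition less_A :: "'a rel \<Rightarrow> 'a list \<Rightarrow> 'a list \<Rightarrow> bool" where
  "less_A A w z \<longleftrightarrow> omega_less A (left_iter w) (left_iter z)"

text \<open>
  Letters are numbered from 1, with indices modulo the length of the word. The conjugate
  \<open>w\<^bsub>i+1\<^esub>\<cdots>w\<^bsub>i\<^esub>\<close> is \<open>rotate i w\<close>.
\<close>

definition letter :: "'a list \<Rightarrow> nat \<Rightarrow> 'a" where
  "letter w i = w ! ((i + length w - 1) mod length w)"

definition T1 :: "'a rel \<Rightarrow> 'a rel \<Rightarrow> 'a list \<Rightarrow> 'a list \<Rightarrow> (nat \<times> nat) set" where
  "T1 D A u v = {(i, j) \<in> {1..length v} \<times> {1..length u}.
     letter v i \<noteq> letter u j \<and>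
     less_A A (rotate j u) (rotate i v) \<and> less_D D (rotate i v) (rotate j u)}"

definition T2 :: "'a rel \<Rightarrow> 'a rel \<Rightarrow> 'a list \<Rightarrow> 'a list \<Rightarrow> (nat \<times> nat) set" where
  "T2 D A u v = {(i, j) \<in> {1..length v} \<times> {1..length u}.
     letter v (i + 1) \<noteq> letter u (j + 1) \<and>
     less_A A (rotate i v) (rotate j u) \<and> less_D D (rotate j u) (rotate i v)}"

definition Omega :: "'a::finite rel \<Rightarrow> 'a rel \<Rightarrow> real ^ 'a ^ 'a" where
  "Omega D A = (\<chi> i j.
     if (j, i) \<in> A \<and> (i, j) \<in> D then 1
     else if (j, i) \<in> D \<and> (i, j) \<in> A then - 1
     else 0)"

lemma transpose_Omega:
  assumes "strict_linear_order D"
  shows "transpose (Omega D A) = - Omega D A"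
proof -
  have asym: "\<not> ((i, j) \<in> D \<and> (j, i) \<in> D)" for i j
    using assms unfolding strict_linear_order_on_def irrefl_def by (metis transD)
  have "Omega D A $ j $ i = - (Omega D A $ i $ j)" for i j
    using asym[of i j] by (cases "(i, j) \<in> D"; cases "(j, i) \<in> D") (simp_all add: Omega_def)
  then have "transpose (Omega D A) $ i $ j = (- Omega D A) $ i $ j" for i j
    unfolding transpose_def vec_lambda_beta vector_uminus_component .
  then show ?thesis
    unfolding vec_eq_iff by blast
qed

end

theory Submission
  imports Defs
begin

text \<open>
  Think of a pair of conjugates \<open>p\<close> of \<open>v\<close> and \<open>q\<close> of \<open>u\<close> as two bi-infinite periodic words with a
  marked position: \<open><\<^sub>D\<close> compares the right halves \<open>p\<^sup>\<omega>\<close> and \<open>q\<^sup>\<omega>\<close>, and \<open><\<^sub>A\<close> compares the left halves.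
  Moving both marks one letter to the right replaces \<open>(p, q)\<close> by \<open>(rotate1 p, rotate1 q)\<close>, and the
  letters \<open>hd p\<close> and \<open>hd q\<close> pass from the right halves to the left halves. If they agree, neither
  comparison changes (\<open>less_D_step\<close>, \<open>less_A_step\<close>). If they differ, the letters alone decide the
  \<open><\<^sub>D\<close>-comparison before the move and the \<open><\<^sub>A\<close>-comparison after it, and by periodicity the other two
  comparisons are strict as well (\<open>tail_comparisons_strict\<close>).

  The condition of \<open>T2\<close> concerns the pair before the move and that of \<open>T1\<close> the pair after it. The
  entry of \<open>\<Omega>\<close> at the letters \<open>hd q\<close> and \<open>hd p\<close> mixes the two: it combines the \<open><\<^sub>A\<close>-comparison after the
  move with the \<open><\<^sub>D\<close>-comparison before it. Write \<open>P\<close> and \<open>P'\<close> for the truth values (0 or 1) of \<open>p <\<^sub>A q\<close>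
  before and after the move, and \<open>Q\<close> and \<open>Q'\<close> for those of \<open>q <\<^sub>D p\<close>. When the letters differ, expanding
  the products gives
  \<open>P Q - (1 - P') (1 - Q') - (P' Q - (1 - P') (1 - Q)) = (1 - P') Q' - (1 - P) Q\<close>.
  The right side is the increment of the potential \<open>(1 - P) Q\<close>, which records \<open>q <\<^sub>A p \<and> q <\<^sub>D p\<close>
  (\<open>step_identity\<close>). Summed over all pairs of conjugates, the increments cancel because the move
  permutes those pairs cyclically, and the entries of \<open>\<Omega>\<close> add up to the bilinear form in the
  Parikh vectors.
\<close>

section \<open>Lexicographic comparison of periodic words\<close>

lemma omega_less_step:
  assumes "strict_linear_order r"
  shows "omega_less r x y \<longleftrightarrow>
    (if x 0 = y 0 then omega_less r (suffix 1 x) (suffix 1 y) else (x 0, y 0) \<in> r)"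
proof (cases "x 0 = y 0")
  case True
  have irr: "(y 0, y 0) \<notin> r"
    using assms unfolding strict_linear_order_on_def irrefl_def by blast
  have "omega_less r x y \<longleftrightarrow> (\<exists>n. (\<forall>m<Suc n. x m = y m) \<and> (x (Suc n), y (Suc n)) \<in> r)"
    unfolding omega_less_def using True irr by (metis not0_implies_Suc)
  also have "\<dots> \<longleftrightarrow> omega_less r (suffix 1 x) (suffix 1 y)"
    unfolding omega_less_def using True by (simp add: All_less_Suc2)
  finally show ?thesis
    using True by simp
next
  case False
  then have "omega_less r x y \<longleftrightarrow> (x 0, y 0) \<in> r"
    unfolding omega_less_def by (metis gr0I not_less0)
  then show ?thesis
    using False by simp
qed

lemma omega_less_antisym:
  assumes "strict_linear_order r" and "omega_less r x y"
  shows "\<not> omega_less r y x"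
proof
  assume "omega_less r y x"
  then obtain m where m: "\<forall>k<m. y k = x k" "(y m, x m) \<in> r"
    unfolding omega_less_def by blast
  obtain n where n: "\<forall>k<n. x k = y k" "(x n, y n) \<in> r"
    using assms(2) unfolding omega_less_def by blast
  have irr: "(a, a) \<notin> r" for a
    using assms(1) unfolding strict_linear_order_on_def irrefl_def by blast
  have "m = n"
    using m n irr by (metis linorder_neqE_nat)
  then show False
    using m(2) n(2) irr assms(1) unfolding strict_linear_order_on_def by (metis transD)
qed

lemma omega_less_total:
  assumes "strict_linear_order r" and "x \<noteq> y"
  shows "omega_less r x y \<or> omega_less r y x"
proof -
  define n where "n = (LEAST n. x n \<noteq> y n)"
  have "\<exists>k. x k \<noteq> y k"
    using assms(2) by blast
  then have ne: "x n \<noteq> y n"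
    unfolding n_def by (rule LeastI_ex)
  have "\<forall>m<n. x m = y m"
    unfolding n_def using not_less_Least by blast
  moreover have "(x n, y n) \<in> r \<or> (y n, x n) \<in> r"
    using assms(1) ne unfolding strict_linear_order_on_def total_on_def by blast
  ultimately show ?thesis
    unfolding omega_less_def by (auto intro!: exI[of _ n])
qed

lemma omega_less_flip:
  assumes "strict_linear_order r" and "x \<noteq> y"
  shows "omega_less r x y \<longleftrightarrow> \<not> omega_less r y x"
  using omega_less_antisym omega_less_total assms by metis

lemma iter_0: "w \<noteq> [] \<Longrightarrow> (w\<^sup>\<omega>) 0 = hd w"
  by (simp add: hd_conv_nth)

lemma suffix_iter: "w \<noteq> [] \<Longrightarrow> suffix 1 (w\<^sup>\<omega>) = (rotate1 w)\<^sup>\<omega>"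
  by (rule ext) (simp add: nth_rotate1 mod_Suc_eq)

text \<open>Both words have the period \<open>length p * length q\<close>, so a difference at position 0 recurs later.\<close>

lemma rotate1_iter_neq:
  assumes "p \<noteq> []" and "q \<noteq> []" and "hd p \<noteq> hd q"
  shows "(rotate1 p)\<^sup>\<omega> \<noteq> (rotate1 q)\<^sup>\<omega>"
proof
  assume eq: "(rotate1 p)\<^sup>\<omega> = (rotate1 q)\<^sup>\<omega>"
  define n where "n = length p * length q"
  have "n > 0"
    using assms unfolding n_def by simp
  then have "(p\<^sup>\<omega>) n = suffix 1 (p\<^sup>\<omega>) (n - 1)" "(q\<^sup>\<omega>) n = suffix 1 (q\<^sup>\<omega>) (n - 1)"
    by simp_all
  then have "(p\<^sup>\<omega>) n = (q\<^sup>\<omega>) n"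
    using eq assms(1,2) by (simp only: suffix_iter not_False_eq_True)
  moreover have "(p\<^sup>\<omega>) n = hd p" "(q\<^sup>\<omega>) n = hd q"
    using assms(1,2) by (simp_all add: n_def hd_conv_nth)
  ultimately show False
    using assms(3) by simp
qed

text \<open>
  Read from right to left, the mark moves the other way: the reversed word of \<open>w\<close> is a rotation of
  that of \<open>rotate1 w\<close>. This lets the left halves be treated by the facts about right halves.
\<close>

lemma rotate1_rev_rotate1: "rotate1 (rev (rotate1 w)) = rev w"
  by (cases w) simp_all

lemma hd_rev_rotate1: "w \<noteq> [] \<Longrightarrow> hd (rev (rotate1 w)) = hd w"
  by (cases w) simp_all

section \<open>Moving the mark by one letter\<close>

lemma less_D_step:
  assumes "strict_linear_order D" and "p \<noteq> []" and "q \<noteq> []"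
  shows "less_D D p q \<longleftrightarrow>
    (if hd p = hd q then less_D D (rotate1 p) (rotate1 q) else (hd p, hd q) \<in> D)"
  unfolding less_D_def omega_less_step[OF assms(1), of "p\<^sup>\<omega>"]
    iter_0[OF assms(2)] iter_0[OF assms(3)] suffix_iter[OF assms(2)] suffix_iter[OF assms(3)] ..

lemma less_A_step:
  assumes "strict_linear_order A" and "p \<noteq> []" and "q \<noteq> []"
  shows "less_A A (rotate1 p) (rotate1 q) \<longleftrightarrow>
    (if hd p = hd q then less_A A p q else (hd p, hd q) \<in> A)"
  using less_D_step[OF assms(1), of "rev (rotate1 p)" "rev (rotate1 q)"] assms(2,3)
  by (simp add: less_A_def less_D_def left_iter_def rotate1_rev_rotate1 hd_rev_rotate1)

lemma tail_comparisons_strict: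
  assumes "strict_linear_order D" and "strict_linear_order A"
    and "p \<noteq> []" and "q \<noteq> []" and "hd p \<noteq> hd q"
  shows "less_D D (rotate1 p) (rotate1 q) \<longleftrightarrow> \<not> less_D D (rotate1 q) (rotate1 p)"
    and "less_A A p q \<longleftrightarrow> \<not> less_A A q p"
proof -
  show "less_D D (rotate1 p) (rotate1 q) \<longleftrightarrow> \<not> less_D D (rotate1 q) (rotate1 p)"
    unfolding less_D_def using omega_less_flip assms(1) rotate1_iter_neq[OF assms(3-5)] by blast
  have "(rev p)\<^sup>\<omega> \<noteq> (rev q)\<^sup>\<omega>"
    using rotate1_iter_neq[of "rev (rotate1 p)" "rev (rotate1 q)"] assms(3-5)
    by (simp add: rotate1_rev_rotate1 hd_rev_rotate1)
  then show "less_A A p q \<longleftrightarrow> \<not> less_A A q p"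
    unfolding less_A_def left_iter_def using omega_less_flip assms(2) by blast
qed

text \<open>
  When \<open>hd p = hd q\<close>, both sides vanish: nothing is counted and the potential is unchanged. Otherwise
  every comparison is strict, and the identity is the polynomial identity in the four truth values
  stated in the introduction.
\<close>

lemma step_identity:
  assumes D: "strict_linear_order D" and A: "strict_linear_order A"
    and p: "p \<noteq> []" and q: "q \<noteq> []"
  defines "g \<equiv> \<lambda>p q. of_bool (less_A A q p \<and> less_D D q p) :: real"
  shows "of_bool (hd p \<noteq> hd q \<and> less_A A p q \<and> less_D D q p)
      - of_bool (hd p \<noteq> hd q \<and> less_A A (rotate1 q) (rotate1 p) \<and> less_D D (rotate1 p) (rotate1 q))
      - Omega D A $ hd q $ hd p
    = g (rotate1 p) (rotate1 q) - g p q"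
proof (cases "hd p = hd q")
  case True
  have "(hd q, hd q) \<notin> D"
    using D unfolding strict_linear_order_on_def irrefl_def by blast
  then show ?thesis
    using True less_D_step[OF D q p] less_A_step[OF A q p] by (simp add: g_def Omega_def)
next
  case False
  have flip: "(hd q, hd p) \<in> r \<longleftrightarrow> (hd p, hd q) \<notin> r" if "strict_linear_order r" for r
    using that False unfolding strict_linear_order_on_def total_on_def irrefl_def
    by (metis UNIV_I transD)
  show ?thesis
    using False tail_comparisons_strict[OF D A p q False] flip[OF D] flip[OF A]
      less_D_step[OF D p q] less_D_step[OF D q p] less_A_step[OF A p q] less_A_step[OF A q p]
    by (auto simp: g_def Omega_def)
qed

section \<open>Summation over all pairs of conjugates\<close>

lemma sum_rotate_Suc:
  fixes F :: "'b list \<Rightarrow> 'c::ab_group_add"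
  shows "(\<Sum>i<length w. F (rotate (Suc i) w)) = (\<Sum>i<length w. F (rotate i w))"
proof -
  have "F w + (\<Sum>i<length w. F (rotate (Suc i) w)) = (\<Sum>i<Suc (length w). F (rotate i w))"
    by (subst sum.lessThan_Suc_shift) simp
  also have "\<dots> = (\<Sum>i<length w. F (rotate i w)) + F w"
    by simp
  finally show ?thesis
    by (simp add: add.commute)
qed

lemma sum_rotate_Suc2:
  fixes F :: "'b list \<Rightarrow> 'b list \<Rightarrow> 'c::ab_group_add"
  shows "(\<Sum>i<length v. \<Sum>j<length u. F (rotate (Suc i) v) (rotate (Suc j) u))
    = (\<Sum>i<length v. \<Sum>j<length u. F (rotate i v) (rotate j u))"
  using sum_rotate_Suc[of "\<lambda>p. \<Sum>j<length u. F p (rotate j u)" v]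
  by (simp only: sum_rotate_Suc[of "F _" u])

lemma card_pairs_eq_sum:
  "real (card {(i, j) \<in> {1..r} \<times> {1..s}. Q i j})
    = (\<Sum>i<r. \<Sum>j<s. of_bool (Q (Suc i) (Suc j)))"
proof -
  have "real (card {(i, j) \<in> {1..r} \<times> {1..s}. Q i j})
      = (\<Sum>z \<in> {1..r} \<times> {1..s}. of_bool (case z of (i, j) \<Rightarrow> Q i j))"
    by (subst sum_of_bool_eq) (auto intro!: arg_cong[where f = card])
  also have "\<dots> = (\<Sum>i = 1..r. \<Sum>j = 1..s. of_bool (Q i j))"
    unfolding sum.cartesian_product by (rule sum.cong) auto
  also have "\<dots> = (\<Sum>i<r. \<Sum>j<s. of_bool (Q (Suc i) (Suc j)))"
    by (simp add: sum.atLeast1_atMost_eq lessThan_atLeast0)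
  finally show ?thesis .
qed

lemma letter_Suc: "w \<noteq> [] \<Longrightarrow> letter w (Suc i) = hd (rotate i w)"
  by (simp add: letter_def hd_rotate_conv_nth)

lemma sum_count_list:
  fixes f :: "'a::finite \<Rightarrow> real"
  shows "(\<Sum>a\<in>UNIV. real (count_list w a) * f a) = (\<Sum>i<length w. f (hd (rotate i w)))"
proof -
  have "(\<Sum>a\<in>UNIV. real (count_list w a) * f a) = sum_list (map f w)"
  proof (induction w)
    case (Cons b w)
    have "real (count_list (b # w) a) * f a
        = real (count_list w a) * f a + (if a = b then f a else 0)" for a
      by (simp add: algebra_simps)
    then show ?case
      using Cons by (simp add: sum.distrib)
  qed simp
  also have "\<dots> = (\<Sum>i<length w. f (w ! i))"
    by (simp add: sum_list_sum_nth lessThan_atLeast0)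
  also have "\<dots> = (\<Sum>i<length w. f (hd (rotate i w)))"
    by (rule sum.cong[OF refl]) (metis hd_rotate_conv_nth lessThan_iff list.size(3) mod_less
        not_less_zero)
  finally show ?thesis .
qed

lemma parikh_bilinear_form:
  "parikh u \<bullet> (M *v parikh v)
    = (\<Sum>i<length v. \<Sum>j<length u. M $ hd (rotate j u) $ hd (rotate i v))"
proof -
  have "parikh u \<bullet> (M *v parikh v)
      = (\<Sum>a\<in>UNIV. real (count_list u a) * (\<Sum>b\<in>UNIV. real (count_list v b) * M $ a $ b))"
    by (simp add: parikh_def inner_vec_def matrix_vector_mult_def mult.commute)
  also have "\<dots> = (\<Sum>j<length u. \<Sum>i<length v. M $ hd (rotate j u) $ hd (rotate i v))"
    by (simp only: sum_count_list)
  finally show ?thesis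
    by (simp only: sum.swap[of _ "{..<length v}"])
qed

theorem theorem1:
  fixes D A :: "'a::finite rel" and u v :: "'a list"
  assumes "strict_linear_order D" and "strict_linear_order A" and "D \<noteq> A"
    and "u \<noteq> []" and "v \<noteq> []"
  shows "real (card (T2 D A u v)) - real (card (T1 D A u v)) =
    parikh u \<bullet> (Omega D A *v parikh v)"
proof -
  let ?sum = "\<lambda>F. \<Sum>i<length v. \<Sum>j<length u. F (rotate i v) (rotate j u) :: real"
  let ?t2 = "\<lambda>p q. of_bool (hd p \<noteq> hd q \<and> less_A A p q \<and> less_D D q p) :: real"
  let ?t1 = "\<lambda>p q. of_bool (hd p \<noteq> hd q \<and> less_A A (rotate1 q) (rotate1 p)
      \<and> less_D D (rotate1 p) (rotate1 q)) :: real"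
  let ?om = "\<lambda>p q. Omega D A $ hd q $ hd p"
  let ?g = "\<lambda>p q. of_bool (less_A A q p \<and> less_D D q p) :: real"
  have T2: "real (card (T2 D A u v)) = ?sum ?t2"
    unfolding T2_def card_pairs_eq_sum sum_rotate_Suc2[of ?t2, symmetric]
    using assms(4,5) by (simp add: letter_Suc del: rotate_Suc)
  have T1: "real (card (T1 D A u v)) = ?sum ?t1"
    unfolding T1_def card_pairs_eq_sum
    using assms(4,5) by (simp add: letter_Suc)
  have "?sum ?t2 - ?sum ?t1 - ?sum ?om = ?sum (\<lambda>p q. ?t2 p q - ?t1 p q - ?om p q)"
    by (simp only: sum_subtractf)
  also have "\<dots> = ?sum (\<lambda>p q. ?g (rotate1 p) (rotate1 q) - ?g p q)"
    using assms(4,5) by (intro sum.cong refl step_identity assms(1,2)) simp_all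
  also have "\<dots> = 0"
    using sum_rotate_Suc2[where F = ?g and u = u and v = v] by (simp add: sum_subtractf)
  finally show ?thesis
    unfolding T1 T2 parikh_bilinear_form by simp
qed

end
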